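(* Consider the system $$\Delta_1:=u_t+2uu_x-v_x=0,\qquad \Delta_2:=v_t+(u^2-1)u_x=0$$ (equivalently $u_t+(u^2-v)_x=0$, $v_t+(\frac13u^3-u)_x=0$). A projectable smooth vector field $$\mathbf w=\xi(x,t)\partial_x+\tau(x,t)\partial_t+\phi(x,t,u,v)\partial_u+\psi(x,t,u,v)\partial_v$$ on $\mathbb R^4$ is an infinitesimal symmetry of the system if and only if there are constants $c_1,\dots,c_5\in\mathbb R$ with $$\xi=c_1x+c_3t+c_4,\qquad\tau=c_1t+c_2,\qquad\phi=c_3,\qquad\psi=c_3u+c_5 .$$ Equivalently, the projectable infinitesimal symmetries are spanned by the linearly independent vector fields $$x\partial_x+t\partial_t,\quad\partial_t,\quad t\partial_x+\partial_u+u\partial_v,\quad\partial_x,\quad\partial_v .$$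
   Context: The first prolongation of $\mathbf w$ is $\mathrm{pr}^{(1)}\mathbf w=\mathbf w+\phi^x\partial_{u_x}+\phi^t\partial_{u_t}+\psi^x\partial_{v_x}+\psi^t\partial_{v_t}$, a vector field on the first jet space with coordinates $(x,t,u,v,u_x,u_t,v_x,v_t)$, where, with $D_x,D_t$ the total derivatives and $\xi,\tau$ functions of $(x,t)$ only, $$\phi^x=D_x\phi-\xi_xu_x-\tau_xu_t,\quad \phi^t=D_t\phi-\xi_tu_x-\tau_tu_t,$$ $$\psi^x=D_x\psi-\xi_xv_x-\tau_xv_t,\quad \psi^t=D_t\psi-\xi_tv_x-\tau_tv_t .$$ Here $D_x\phi=\phi_x+\phi_uu_x+\phi_vv_x$, and similarly for the others. The vector field $\mathbf w$ is an infinitesimal symmetry of the system if $\mathrm{pr}^{(1)}\mathbf w(\Delta_1)=0$ and $\mathrm{pr}^{(1)}\mathbf w(\Delta_2)=0$ at all points of the jet space where $\Delta_1=\Delta_2=0$. Projectable means that $\xi,\tau$ do not depend on $u,v$. *)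

theory Defs
  imports "HOL-Analysis.Analysis" "HOL-Library.Function_Algebras"
begin

text \<open>Coordinates: \<open>(x, t)\<close> on the base, \<open>(x, t, u, v)\<close> on the total space,
  \<open>(x, t, u, v, u\<^sub>x, u\<^sub>t, v\<^sub>x, v\<^sub>t)\<close> on the first jet space.
  A vector field on one of these spaces is the map sending a point to its coefficient tuple.\<close>

type_synonym base = "real \<times> real"
type_synonym total = "real \<times> real \<times> real \<times> real"
type_synonym jet = "real \<times> real \<times> real \<times> real \<times> real \<times> real \<times> real \<times> real"


section \<open>Smooth maps\<close>

fun C_diff :: "nat \<Rightarrow> ('a::euclidean_space \<Rightarrow> 'b::real_normed_vector) \<Rightarrow> bool" where
  "C_diff 0 f \<longleftrightarrow> continuous_on UNIV f"
| "C_diff (Suc n) f \<longleftrightarrow>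
     (\<forall>p. f differentiable (at p)) \<and> (\<forall>h. C_diff n (\<lambda>p. frechet_derivative f (at p) h))"

definition smooth :: "('a::euclidean_space \<Rightarrow> 'b::real_normed_vector) \<Rightarrow> bool" where
  "smooth f \<longleftrightarrow> (\<forall>n. C_diff n f)"


section \<open>The real vector space of vector fields on the total space\<close>

text \<open>Addition is the pointwise one of \<^theory>\<open>HOL-Library.Function_Algebras\<close>,
  which provides no scalar multiplication.\<close>

definition scale_vf :: "real \<Rightarrow> (total \<Rightarrow> total) \<Rightarrow> (total \<Rightarrow> total)" where
  "scale_vf c X = (\<lambda>p. c *\<^sub>R X p)"

global_interpretation vf: vector_space scale_vf
  by unfold_locales
    (auto simp: scale_vf_def fun_eq_iff scaleR_add_right scaleR_add_left)


section \<open>Partial and total derivatives\<close>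

fun base_dx base_dt :: "(base \<Rightarrow> real) \<Rightarrow> base \<Rightarrow> real" where
  "base_dx f (x, t) = deriv (\<lambda>s. f (s, t)) x"
| "base_dt f (x, t) = deriv (\<lambda>s. f (x, s)) t"

fun total_dx total_dt total_du total_dv :: "(total \<Rightarrow> real) \<Rightarrow> total \<Rightarrow> real" where
  "total_dx f (x, t, u, v) = deriv (\<lambda>s. f (s, t, u, v)) x"
| "total_dt f (x, t, u, v) = deriv (\<lambda>s. f (x, s, u, v)) t"
| "total_du f (x, t, u, v) = deriv (\<lambda>s. f (x, t, s, v)) u"
| "total_dv f (x, t, u, v) = deriv (\<lambda>s. f (x, t, u, s)) v"

fun D_x D_t :: "(total \<Rightarrow> real) \<Rightarrow> jet \<Rightarrow> real" where
  "D_x f (x, t, u, v, ux, ut, vx, vt) =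
     total_dx f (x, t, u, v) + total_du f (x, t, u, v) * ux + total_dv f (x, t, u, v) * vx"
| "D_t f (x, t, u, v, ux, ut, vx, vt) =
     total_dt f (x, t, u, v) + total_du f (x, t, u, v) * ut + total_dv f (x, t, u, v) * vt"


section \<open>The system\<close>

fun Delta1 Delta2 :: "jet \<Rightarrow> real" where
  "Delta1 (x, t, u, v, ux, ut, vx, vt) = ut + 2 * u * ux - vx"
| "Delta2 (x, t, u, v, ux, ut, vx, vt) = vt + (u\<^sup>2 - 1) * ux"

fun jet_of :: "(base \<Rightarrow> real) \<Rightarrow> (base \<Rightarrow> real) \<Rightarrow> base \<Rightarrow> jet" where
  "jet_of u v (x, t) = (x, t, u (x, t), v (x, t),
     base_dx u (x, t), base_dt u (x, t), base_dx v (x, t), base_dt v (x, t))"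


section \<open>Projectable vector fields, prolongation and infinitesimal symmetries\<close>

fun projectable_vf ::
    "(base \<Rightarrow> real) \<Rightarrow> (base \<Rightarrow> real) \<Rightarrow> (total \<Rightarrow> real) \<Rightarrow> (total \<Rightarrow> real) \<Rightarrow> total \<Rightarrow> total" where
  "projectable_vf \<xi> \<tau> \<phi> \<psi> (x, t, u, v) =
     (\<xi> (x, t), \<tau> (x, t), \<phi> (x, t, u, v), \<psi> (x, t, u, v))"

fun prolongation ::
    "(base \<Rightarrow> real) \<Rightarrow> (base \<Rightarrow> real) \<Rightarrow> (total \<Rightarrow> real) \<Rightarrow> (total \<Rightarrow> real) \<Rightarrow> jet \<Rightarrow> jet" where
  "prolongation \<xi> \<tau> \<phi> \<psi> (x, t, u, v, ux, ut, vx, vt) =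
     (\<xi> (x, t), \<tau> (x, t), \<phi> (x, t, u, v), \<psi> (x, t, u, v),
      D_x \<phi> (x, t, u, v, ux, ut, vx, vt) - base_dx \<xi> (x, t) * ux - base_dx \<tau> (x, t) * ut,
      D_t \<phi> (x, t, u, v, ux, ut, vx, vt) - base_dt \<xi> (x, t) * ux - base_dt \<tau> (x, t) * ut,
      D_x \<psi> (x, t, u, v, ux, ut, vx, vt) - base_dx \<xi> (x, t) * vx - base_dx \<tau> (x, t) * vt,
      D_t \<psi> (x, t, u, v, ux, ut, vx, vt) - base_dt \<xi> (x, t) * vx - base_dt \<tau> (x, t) * vt)"

text \<open>The action of a vector field on functions, i.e. the directional derivative along it.\<close>

definition vf_apply :: "('a::euclidean_space \<Rightarrow> 'a) \<Rightarrow> ('a \<Rightarrow> real) \<Rightarrow> 'a \<Rightarrow> real" where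
  "vf_apply X F p = frechet_derivative F (at p) (X p)"

definition infinitesimal_symmetry ::
    "(base \<Rightarrow> real) \<Rightarrow> (base \<Rightarrow> real) \<Rightarrow> (total \<Rightarrow> real) \<Rightarrow> (total \<Rightarrow> real) \<Rightarrow> bool" where
  "infinitesimal_symmetry \<xi> \<tau> \<phi> \<psi> \<longleftrightarrow>
     (\<forall>j. Delta1 j = 0 \<and> Delta2 j = 0 \<longrightarrow>
        vf_apply (prolongation \<xi> \<tau> \<phi> \<psi>) Delta1 j = 0 \<and>
        vf_apply (prolongation \<xi> \<tau> \<phi> \<psi>) Delta2 j = 0)"

definition projectable_symmetries :: "(total \<Rightarrow> total) set" where
  "projectable_symmetries = {projectable_vf \<xi> \<tau> \<phi> \<psi> | \<xi> \<tau> \<phi> \<psi>.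
     smooth (projectable_vf \<xi> \<tau> \<phi> \<psi>) \<and> infinitesimal_symmetry \<xi> \<tau> \<phi> \<psi>}"

definition w1 :: "total \<Rightarrow> total" where "w1 = (\<lambda>(x, t, u, v). (x, t, 0, 0))"
definition w2 :: "total \<Rightarrow> total" where "w2 = (\<lambda>(x, t, u, v). (0, 1, 0, 0))"
definition w3 :: "total \<Rightarrow> total" where "w3 = (\<lambda>(x, t, u, v). (t, 0, 1, u))"
definition w4 :: "total \<Rightarrow> total" where "w4 = (\<lambda>(x, t, u, v). (1, 0, 0, 0))"
definition w5 :: "total \<Rightarrow> total" where "w5 = (\<lambda>(x, t, u, v). (0, 0, 0, 1))"

end

theory Submission
  imports Defs
begin

text \<open>Restricted to the solution set, the two symmetry conditions are affine in the free jet
  variables \<open>u\<^sub>x, v\<^sub>x\<close>, so each splits into three equations. Subtracting two of these expresses \<open>\<phi>\<close>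
  through the first derivatives of \<open>\<xi>, \<tau>\<close>, as a polynomial in \<open>u\<close>; compatibility of the resulting
  \<open>\<psi>\<^sub>u\<close> and \<open>\<psi>\<^sub>v\<close> forces \<open>\<tau>\<^sub>x = 0\<close>, and a further equation then gives \<open>\<xi>\<^sub>x = \<tau>\<^sub>t\<close>. Hence \<open>\<phi> = \<xi>\<^sub>t\<close> and
  \<open>\<psi> = \<xi>\<^sub>t u + \<psi>\<^sub>0(x, t)\<close>; comparing powers of \<open>u\<close> in the remaining equations makes \<open>\<phi>\<close> and
  \<open>\<psi>\<^sub>0\<close> constant. Only first derivatives are needed, since \<open>\<xi>\<^sub>t\<close> is differentiated only as \<open>\<phi>\<close>.\<close>

section \<open>Partial derivatives of differentiable functions\<close>

text \<open>Chain rule along a curve. It certifies that the partial derivatives, which are defined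
  through \<open>deriv\<close>, are genuine derivatives of the coordinate slices of a differentiable
  function.\<close>

lemma has_field_derivative_deriv_compose:
  fixes f :: "'a::real_normed_vector \<Rightarrow> real" and g :: "real \<Rightarrow> 'a"
  assumes "f differentiable (at (g s))" "g differentiable (at s)"
  shows "((\<lambda>s. f (g s)) has_real_derivative deriv (\<lambda>s. f (g s)) s) (at s)"
  using differentiable_chain_at[OF assms(2,1)]
  by (simp add: DERIV_deriv_iff_real_differentiable o_def)

lemma has_field_derivative_base_dx:
  "f differentiable (at (x, t)) \<Longrightarrow> ((\<lambda>s. f (s, t)) has_real_derivative base_dx f (x, t)) (at x)"
  using has_field_derivative_deriv_compose[of f "\<lambda>s. (s, t)" x] by simp

lemma has_field_derivative_base_dt:
  "f differentiable (at (x, t)) \<Longrightarrow> ((\<lambda>s. f (x, s)) has_real_derivative base_dt f (x, t)) (at t)"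
  using has_field_derivative_deriv_compose[of f "\<lambda>s. (x, s)" t] by simp

lemma has_field_derivative_total_dx:
  "f differentiable (at (x, t, u, v)) \<Longrightarrow>
    ((\<lambda>s. f (s, t, u, v)) has_real_derivative total_dx f (x, t, u, v)) (at x)"
  using has_field_derivative_deriv_compose[of f "\<lambda>s. (s, t, u, v)" x] by simp

lemma has_field_derivative_total_dt:
  "f differentiable (at (x, t, u, v)) \<Longrightarrow>
    ((\<lambda>s. f (x, s, u, v)) has_real_derivative total_dt f (x, t, u, v)) (at t)"
  using has_field_derivative_deriv_compose[of f "\<lambda>s. (x, s, u, v)" t] by simp

lemma has_field_derivative_total_du:
  "f differentiable (at (x, t, u, v)) \<Longrightarrow>
    ((\<lambda>s. f (x, t, s, v)) has_real_derivative total_du f (x, t, u, v)) (at u)"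
  using has_field_derivative_deriv_compose[of f "\<lambda>s. (x, t, s, v)" u] by simp

lemma has_field_derivative_total_dv:
  "f differentiable (at (x, t, u, v)) \<Longrightarrow>
    ((\<lambda>s. f (x, t, u, s)) has_real_derivative total_dv f (x, t, u, v)) (at v)"
  using has_field_derivative_deriv_compose[of f "\<lambda>s. (x, t, u, s)" v] by simp

text \<open>Partial derivatives now act as atoms in algebraic simplification; they are unfolded only
  where one is computed from an explicit formula.\<close>

declare base_dx.simps [simp del] base_dt.simps [simp del] total_dx.simps [simp del]
  total_dt.simps [simp del] total_du.simps [simp del] total_dv.simps [simp del]

section \<open>Real functions recovered from their derivatives\<close>

lemma eq_if_same_real_derivative:
  fixes f g :: "real \<Rightarrow> real"
  assumes "\<And>s. (f has_real_derivative h s) (at s)"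
    and "\<And>s. (g has_real_derivative h s) (at s)"
  shows "f a - f b = g a - g b"
proof -
  have "((\<lambda>s. f s - g s) has_real_derivative 0) (at s)" for s
    using DERIV_diff[OF assms(1)[of s] assms(2)[of s]] by simp
  then have "f a - g a = f b - g b"
    by (intro DERIV_isconst_all) blast
  then show ?thesis by simp
qed

lemma affine_if_const_real_derivative:
  fixes f :: "real \<Rightarrow> real"
  assumes "\<And>s. (f has_real_derivative c) (at s)"
  shows "f s = c * s + f 0"
proof -
  have "((\<lambda>s. c * s) has_real_derivative c) (at s)" for s
    by (auto intro!: derivative_eq_intros)
  from eq_if_same_real_derivative[OF assms this, of s 0] show ?thesis by simp
qed

lemma const_if_zero_real_derivative:
  fixes f :: "real \<Rightarrow> real"
  assumes "\<And>s. (f has_real_derivative 0) (at s)"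
  shows "f s = f s'"
  using DERIV_isconst_all assms by blast


section \<open>Conservation-law form\<close>

text \<open>Chain rule on the x-slice through \<open>p\<close>: differentiating the two fluxes gives
  the quasilinear terms of the system.\<close>

lemma system_iff_conservation_laws:
  fixes u v :: "base \<Rightarrow> real"
  assumes "u differentiable (at p)" "v differentiable (at p)"
  shows "Delta1 (jet_of u v p) = 0 \<and> Delta2 (jet_of u v p) = 0 \<longleftrightarrow>
    base_dt u p + base_dx (\<lambda>q. (u q)\<^sup>2 - v q) p = 0 \<and>
    base_dt v p + base_dx (\<lambda>q. 1 / 3 * (u q) ^ 3 - u q) p = 0"
proof (cases p)
  case (Pair x t)
  note [derivative_intros] = has_field_derivative_base_dx[OF assms(1)[unfolded Pair]]
    has_field_derivative_base_dx[OF assms(2)[unfolded Pair]]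
  have "((\<lambda>s. (u (s, t))\<^sup>2 - v (s, t)) has_real_derivative
      2 * u (x, t) * base_dx u (x, t) - base_dx v (x, t)) (at x)"
    by (rule derivative_eq_intros refl)+ simp
  then have 1: "base_dx (\<lambda>q. (u q)\<^sup>2 - v q) (x, t) =
      2 * u (x, t) * base_dx u (x, t) - base_dx v (x, t)"
    \<comment> \<open>The defining equation is instantiated at the flux, so that
      \<open>base_dx u\<close> and \<open>base_dx v\<close> stay folded.\<close>
    by (simp add: base_dx.simps(1)[of "\<lambda>q. (u q)\<^sup>2 - v q"] DERIV_imp_deriv)
  have "((\<lambda>s. 1 / 3 * (u (s, t)) ^ 3 - u (s, t)) has_real_derivative
      ((u (x, t))\<^sup>2 - 1) * base_dx u (x, t)) (at x)"
    by (rule derivative_eq_intros refl)+ (simp add: algebra_simps power2_eq_square)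
  then have 2: "base_dx (\<lambda>q. 1 / 3 * (u q) ^ 3 - u q) (x, t) =
      ((u (x, t))\<^sup>2 - 1) * base_dx u (x, t)"
    by (simp only: base_dx.simps(1)[of "\<lambda>q. 1 / 3 * (u q) ^ 3 - u q"] DERIV_imp_deriv)
  show ?thesis
    unfolding Pair 1 2 by (simp add: algebra_simps)
qed


section \<open>Determining equations\<close>

text \<open>The differential of \<open>Delta1\<close>, by the product rule; \<open>c\<close>,
  \<open>cx\<close>, \<open>ct\<close>, \<open>dx\<close> are the components of the field along u,
  u_x, u_t, v_x.\<close>

lemma vf_apply_Delta1:
  assumes "X (x, t, u, v, ux, ut, vx, vt) = (a, b, c, d, cx, ct, dx, dt)"
  shows "vf_apply X Delta1 (x, t, u, v, ux, ut, vx, vt) = ct + 2 * c * ux + 2 * u * cx - dx"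
proof -
  \<comment> \<open>Coordinates are written as projections, to which the derivative rules
    apply.\<close>
  have D: "Delta1 = (\<lambda>j. fst (snd (snd (snd (snd (snd j)))))
      + 2 * fst (snd (snd j)) * fst (snd (snd (snd (snd j))))
      - fst (snd (snd (snd (snd (snd (snd j)))))))"
    by (auto simp: fun_eq_iff)
  have "(Delta1 has_derivative (\<lambda>h. fst (snd (snd (snd (snd (snd h)))))
      + 2 * fst (snd (snd h)) * ux + 2 * u * fst (snd (snd (snd (snd h))))
      - fst (snd (snd (snd (snd (snd (snd h))))))))
    (at (x, t, u, v, ux, ut, vx, vt))"
    unfolding D by (rule derivative_eq_intros refl)+ (simp add: fun_eq_iff algebra_simps)
  from frechet_derivative_at[OF this, symmetric] show ?thesis
    by (simp add: vf_apply_def assms)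
qed

lemma vf_apply_Delta2:
  assumes "X (x, t, u, v, ux, ut, vx, vt) = (a, b, c, d, cx, ct, dx, dt)"
  shows "vf_apply X Delta2 (x, t, u, v, ux, ut, vx, vt) = dt + 2 * u * c * ux + (u\<^sup>2 - 1) * cx"
proof -
  have D: "Delta2 = (\<lambda>j. snd (snd (snd (snd (snd (snd (snd j))))))
      + ((fst (snd (snd j)))\<^sup>2 - 1) * fst (snd (snd (snd (snd j)))))"
    by (auto simp: fun_eq_iff)
  have "(Delta2 has_derivative (\<lambda>h. snd (snd (snd (snd (snd (snd (snd h))))))
      + 2 * u * fst (snd (snd h)) * ux + (u\<^sup>2 - 1) * fst (snd (snd (snd (snd h))))))
    (at (x, t, u, v, ux, ut, vx, vt))"
    unfolding D by (rule derivative_eq_intros refl)+ (simp add: fun_eq_iff algebra_simps)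
  from frechet_derivative_at[OF this, symmetric] show ?thesis
    by (simp add: vf_apply_def assms)
qed

text \<open>Evaluation at (0, 0), (1, 0) and (0, 1) isolates the coefficients. This is the splitting
  in the free jet coordinates.\<close>

lemma affine_eq_zero_iff:
  fixes a b c :: real
  shows "(\<forall>p q. a + b * p + c * q = 0) \<longleftrightarrow> a = 0 \<and> b = 0 \<and> c = 0"
proof
  assume *: "\<forall>p q. a + b * p + c * q = 0"
  show "a = 0 \<and> b = 0 \<and> c = 0"
    using *[rule_format, of 0 0] *[rule_format, of 1 0] *[rule_format, of 0 1] by simp
qed simp

text \<open>On the solution set \<open>u\<^sub>t = v\<^sub>x - 2uu\<^sub>x\<close> and \<open>v\<^sub>t = (1 - u\<^sup>2)u\<^sub>x\<close>, with \<open>u\<^sub>x, v\<^sub>x\<close> free.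
  The equations are the coefficients of \<open>1, u\<^sub>x, v\<^sub>x\<close> in the two symmetry conditions.\<close>

definition determining_equations ::
    "(base \<Rightarrow> real) \<Rightarrow> (base \<Rightarrow> real) \<Rightarrow> (total \<Rightarrow> real) \<Rightarrow> (total \<Rightarrow> real) \<Rightarrow> total \<Rightarrow> bool" where
  "determining_equations \<xi> \<tau> \<phi> \<psi> = (\<lambda>(x, t, u, v).
    (let \<xi>x = base_dx \<xi> (x, t); \<xi>t = base_dt \<xi> (x, t);
         \<tau>x = base_dx \<tau> (x, t); \<tau>t = base_dt \<tau> (x, t);
         p = (x, t, u, v)
     in total_dt \<phi> p + 2 * u * total_dx \<phi> p - total_dx \<psi> p = 0 \<and>
        (1 - u\<^sup>2) * total_dv \<phi> p - \<xi>t + 2 * u * \<tau>t + 2 * \<phi> p - 2 * u * \<xi>x + 4 * u\<^sup>2 * \<tau>x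
          - total_du \<psi> p + (1 - u\<^sup>2) * \<tau>x = 0 \<and>
        total_du \<phi> p - \<tau>t + 2 * u * (total_dv \<phi> p - \<tau>x) - total_dv \<psi> p + \<xi>x = 0 \<and>
        total_dt \<psi> p + (u\<^sup>2 - 1) * total_dx \<phi> p = 0 \<and>
        - 2 * u * total_du \<psi> p + (1 - u\<^sup>2) * (total_dv \<psi> p - \<tau>t) + 2 * u * \<phi> p
          + (u\<^sup>2 - 1) * (total_du \<phi> p - \<xi>x + 2 * u * \<tau>x) = 0 \<and>
        total_du \<psi> p - \<xi>t + (u\<^sup>2 - 1) * (total_dv \<phi> p - \<tau>x) = 0))"

text \<open>The solution set is a graph over (x, t, u, v, u_x, v_x). Since the field is projectable,
  its prolongation is affine in the first-order jet coordinates, so on this graph both conditions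
  are affine in u_x and v_x.\<close>

lemma infinitesimal_symmetry_iff_determining_equations:
  "infinitesimal_symmetry \<xi> \<tau> \<phi> \<psi> \<longleftrightarrow> (\<forall>p. determining_equations \<xi> \<tau> \<phi> \<psi> p)"
proof -
  \<comment> \<open>\<open>p\<close> and \<open>q\<close> stand for u_x and v_x; the other two jet
    coordinates are already eliminated.\<close>
  define C where "C x t u v p q \<longleftrightarrow>
     vf_apply (prolongation \<xi> \<tau> \<phi> \<psi>) Delta1 (x, t, u, v, p, q - 2 * u * p, q, (1 - u\<^sup>2) * p) = 0 \<and>
     vf_apply (prolongation \<xi> \<tau> \<phi> \<psi>) Delta2 (x, t, u, v, p, q - 2 * u * p, q, (1 - u\<^sup>2) * p) = 0"
    for x t u v p q
  have on_shell: "Delta1 (x, t, u, v, p, r, q, s) = 0 \<and> Delta2 (x, t, u, v, p, r, q, s) = 0 \<longleftrightarrow>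
      r = q - 2 * u * p \<and> s = (1 - u\<^sup>2) * p" for x t u v p r q s
    by (auto simp: algebra_simps)
  have "infinitesimal_symmetry \<xi> \<tau> \<phi> \<psi> \<longleftrightarrow> (\<forall>x t u v p q. C x t u v p q)"
    unfolding infinitesimal_symmetry_def split_paired_All on_shell C_def by blast
  moreover have "(\<forall>p q. C x t u v p q) \<longleftrightarrow> determining_equations \<xi> \<tau> \<phi> \<psi> (x, t, u, v)"
    for x t u v
  proof -
    define z where "z = (x, t, u, v)"
    define \<xi>x \<xi>t \<tau>x \<tau>t where
      "\<xi>x = base_dx \<xi> (x, t)" "\<xi>t = base_dt \<xi> (x, t)"
      "\<tau>x = base_dx \<tau> (x, t)" "\<tau>t = base_dt \<tau> (x, t)"
    note defs = \<xi>x_\<xi>t_\<tau>x_\<tau>t_def z_def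
    note folds = defs[symmetric]
    define a1 b1 c1 a2 b2 c2 where coeffs:
      "a1 = total_dt \<phi> z + 2 * u * total_dx \<phi> z - total_dx \<psi> z"
      "b1 = (1 - u\<^sup>2) * total_dv \<phi> z - \<xi>t + 2 * u * \<tau>t + 2 * \<phi> z - 2 * u * \<xi>x + 4 * u\<^sup>2 * \<tau>x
          - total_du \<psi> z + (1 - u\<^sup>2) * \<tau>x"
      "c1 = total_du \<phi> z - \<tau>t + 2 * u * (total_dv \<phi> z - \<tau>x) - total_dv \<psi> z + \<xi>x"
      "a2 = total_dt \<psi> z + (u\<^sup>2 - 1) * total_dx \<phi> z"
      "b2 = - 2 * u * total_du \<psi> z + (1 - u\<^sup>2) * (total_dv \<psi> z - \<tau>t) + 2 * u * \<phi> z
          + (u\<^sup>2 - 1) * (total_du \<phi> z - \<xi>x + 2 * u * \<tau>x)"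
      "c2 = total_du \<psi> z - \<xi>t + (u\<^sup>2 - 1) * (total_dv \<phi> z - \<tau>x)"
    have "C x t u v p q \<longleftrightarrow> a1 + b1 * p + c1 * q = 0 \<and> a2 + b2 * p + c2 * q = 0" for p q
    proof -
      have "vf_apply (prolongation \<xi> \<tau> \<phi> \<psi>) Delta1
          (x, t, u, v, p, q - 2 * u * p, q, (1 - u\<^sup>2) * p) = a1 + b1 * p + c1 * q"
        \<comment> \<open>Solving the premise with \<open>prolongation.simps\<close> supplies the
          field components; a polynomial identity remains.\<close>
        apply (subst vf_apply_Delta1)
         apply (rule prolongation.simps)
        unfolding D_x.simps D_t.simps folds coeffs
        by (simp add: algebra_simps power2_eq_square)
      moreover have "vf_apply (prolongation \<xi> \<tau> \<phi> \<psi>) Delta2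
          (x, t, u, v, p, q - 2 * u * p, q, (1 - u\<^sup>2) * p) = a2 + b2 * p + c2 * q"
        apply (subst vf_apply_Delta2)
         apply (rule prolongation.simps)
        unfolding D_x.simps D_t.simps folds coeffs
        by (simp add: algebra_simps power2_eq_square)
      ultimately show ?thesis
        by (simp add: C_def)
    qed
    then have "(\<forall>p q. C x t u v p q) \<longleftrightarrow>
        (a1 = 0 \<and> b1 = 0 \<and> c1 = 0) \<and> (a2 = 0 \<and> b2 = 0 \<and> c2 = 0)"
      unfolding affine_eq_zero_iff[symmetric] by blast
    also have "\<dots> \<longleftrightarrow> determining_equations \<xi> \<tau> \<phi> \<psi> (x, t, u, v)"
      unfolding coeffs defs determining_equations_def prod.case Let_def by blast
    finally show ?thesis .
  qed
  ultimately show ?thesis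
    by (simp add: split_paired_All)
qed

text \<open>The third conclusion comes from adding the u_x-coefficient of the first condition to the
  v_x-coefficient of the second: \<psi>_u and \<phi>_v cancel and only \<phi> is left. The other
  conclusions rearrange single equations.\<close>

lemma determining_equationsD:
  assumes "determining_equations \<xi> \<tau> \<phi> \<psi> (x, t, u, v)"
  shows "total_dt \<phi> (x, t, u, v) + 2 * u * total_dx \<phi> (x, t, u, v) = total_dx \<psi> (x, t, u, v)"
    and "total_dt \<psi> (x, t, u, v) = (1 - u\<^sup>2) * total_dx \<phi> (x, t, u, v)"
    and "\<phi> (x, t, u, v) = base_dt \<xi> (x, t) + u * (base_dx \<xi> (x, t) - base_dt \<tau> (x, t))
      - (1 + u\<^sup>2) * base_dx \<tau> (x, t)"
    and "total_dv \<psi> (x, t, u, v) = total_du \<phi> (x, t, u, v) + base_dx \<xi> (x, t) - base_dt \<tau> (x, t)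
      + 2 * u * (total_dv \<phi> (x, t, u, v) - base_dx \<tau> (x, t))"
    and "total_du \<psi> (x, t, u, v) =
      base_dt \<xi> (x, t) + (1 - u\<^sup>2) * (total_dv \<phi> (x, t, u, v) - base_dx \<tau> (x, t))"
    and "- 2 * u * total_du \<psi> (x, t, u, v) + (1 - u\<^sup>2) * (total_dv \<psi> (x, t, u, v) - base_dt \<tau> (x, t))
      + 2 * u * \<phi> (x, t, u, v)
      + (u\<^sup>2 - 1) * (total_du \<phi> (x, t, u, v) - base_dx \<xi> (x, t) + 2 * u * base_dx \<tau> (x, t)) = 0"
  using assms unfolding determining_equations_def prod.case Let_def
  by (simp_all add: algebra_simps)

section \<open>Solving the determining equations\<close>

lemma solve_determining_equations:
  assumes diff: "\<And>p. \<xi> differentiable (at p)" "\<And>p. \<tau> differentiable (at p)"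
      "\<And>p. \<phi> differentiable (at p)" "\<And>p. \<psi> differentiable (at p)"
    and det: "\<And>p. determining_equations \<xi> \<tau> \<phi> \<psi> p"
  obtains c1 c2 c3 c4 c5 :: real where
    "\<And>x t. \<xi> (x, t) = c1 * x + c3 * t + c4"
    "\<And>x t. \<tau> (x, t) = c1 * t + c2"
    "\<And>x t u v. \<phi> (x, t, u, v) = c3"
    "\<And>x t u v. \<psi> (x, t, u, v) = c3 * u + c5"
proof -
  note eqs = determining_equationsD[OF det]
  \<comment> \<open>The coefficient of u in \<phi>; its vanishing is the relation \<xi>_x =
    \<tau>_t.\<close>
  define a where "a x t = base_dx \<xi> (x, t) - base_dt \<tau> (x, t)" for x t
  have \<phi>: "\<phi> (x, t, u, v) = base_dt \<xi> (x, t) + u * a x t - (1 + u\<^sup>2) * base_dx \<tau> (x, t)" for x t u v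
    using eqs(3) by (simp add: a_def)
  have \<phi>v: "total_dv \<phi> (x, t, u, v) = 0" for x t u v
    by (simp add: total_dv.simps \<phi>)
  have \<phi>u: "total_du \<phi> (x, t, u, v) = a x t - 2 * u * base_dx \<tau> (x, t)" for x t u v
  proof -
    have "((\<lambda>s. \<phi> (x, t, s, v)) has_real_derivative a x t - 2 * u * base_dx \<tau> (x, t)) (at u)"
      unfolding \<phi> by (rule derivative_eq_intros refl)+ simp
    then show ?thesis by (simp add: total_du.simps DERIV_imp_deriv)
  qed
  have \<psi>v: "total_dv \<psi> (x, t, u, v) = 2 * a x t - 4 * u * base_dx \<tau> (x, t)" for x t u v
    using eqs(4)[of x t u v] by (simp add: \<phi>u \<phi>v a_def)
  have \<psi>u: "total_du \<psi> (x, t, u, v) = base_dt \<xi> (x, t) - (1 - u\<^sup>2) * base_dx \<tau> (x, t)" for x t u v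
    using eqs(5)[of x t u v] by (simp add: \<phi>v)
  \<comment> \<open>Equality of the mixed increments of \<open>\<psi>\<close> in \<open>u\<close> and \<open>v\<close> replaces that of \<open>\<psi>\<^sub>u\<^sub>v\<close> and \<open>\<psi>\<^sub>v\<^sub>u\<close>.\<close>
  have \<psi>_diff_v: "\<psi> (x, t, u, v) - \<psi> (x, t, u, 0) = (2 * a x t - 4 * u * base_dx \<tau> (x, t)) * v" for x t u v
    using affine_if_const_real_derivative[OF has_field_derivative_total_dv[OF diff(4), unfolded \<psi>v], of x t u v]
    by simp
  have \<psi>_diff_u: "\<psi> (x, t, 1, v) - \<psi> (x, t, 0, v) = \<psi> (x, t, 1, w) - \<psi> (x, t, 0, w)" for x t v w
    using eq_if_same_real_derivative[OF
        has_field_derivative_total_du[OF diff(4), unfolded \<psi>u]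
        has_field_derivative_total_du[OF diff(4), unfolded \<psi>u]] .
  \<comment> \<open>On the unit square in (u, v) the increment of \<psi> in v is 2a - 4 \<tau>_x
    along u = 1 and 2a along u = 0; \<open>\<psi>_diff_u\<close> makes the two equal.\<close>
  have \<tau>x: "base_dx \<tau> (x, t) = 0" for x t
    using \<psi>_diff_v[of x t 1 1] \<psi>_diff_v[of x t 0 1] \<psi>_diff_u[of x t 1 0] by simp
  \<comment> \<open>The first instantiated variable of \<open>eqs(6)\<close> is u. At u = 0 the
    equation reads \<psi>_v - \<tau>_t - \<phi>_u + \<xi>_x = 0, whose left side is 2a.\<close>
  have a0: "a x t = 0" for x t
    using eqs(6)[of 0 x t 0] by (simp add: \<psi>v \<psi>u \<phi>u \<phi> \<tau>x) (simp add: a_def)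
  have \<phi>': "\<phi> (x, t, u, v) = base_dt \<xi> (x, t)" for x t u v
    by (simp add: \<phi> a0 \<tau>x)
  have \<psi>': "\<psi> (x, t, u, v) = base_dt \<xi> (x, t) * u + \<psi> (x, t, 0, 0)" for x t u v
  proof -
    \<comment> \<open>Once \<tau>_x = 0, the derivative \<psi>_u = \<xi>_t is constant in u; the
      slope in \<open>\<psi>_diff_v\<close> vanishes as well, which removes v.\<close>
    have "\<psi> (x, t, u, v) = base_dt \<xi> (x, t) * u + \<psi> (x, t, 0, v)"
      by (rule affine_if_const_real_derivative)
        (use has_field_derivative_total_du[OF diff(4), unfolded \<psi>u] in \<open>simp add: \<tau>x\<close>)
    then show ?thesis
      using \<psi>_diff_v[of x t 0 v] by (simp add: a0 \<tau>x)
  qed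
  have \<phi>x_indep: "total_dx \<phi> (x, t, u, v) = total_dx \<phi> (x, t, 0, 0)"
    and \<phi>t_indep: "total_dt \<phi> (x, t, u, v) = total_dt \<phi> (x, t, 0, 0)" for x t u v
    \<comment> \<open>After rewriting with \<open>\<phi>'\<close>, both sides are
      \<open>deriv\<close> of the same function of one variable.\<close>
    by (simp_all add: total_dx.simps total_dt.simps \<phi>')
  have \<psi>t_affine: "total_dt \<psi> (x, t, u, v) = total_dt \<phi> (x, t, 0, 0) * u + total_dt \<psi> (x, t, 0, 0)"
    and \<psi>x_affine: "total_dx \<psi> (x, t, u, v) = total_dx \<phi> (x, t, 0, 0) * u + total_dx \<psi> (x, t, 0, 0)"
    for x t u v
  proof -
    \<comment> \<open>Writing \<xi>_t as \<phi> lets the differentiability of \<phi> supply the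
      derivative of this coefficient.\<close>
    have *: "\<psi> (x, t, u, v) = \<phi> (x, t, 0, 0) * u + \<psi> (x, t, 0, 0)" for x t
      using \<psi>' \<phi>' by metis
    note [derivative_intros] =
      has_field_derivative_total_dt[OF diff(3)] has_field_derivative_total_dt[OF diff(4)]
      has_field_derivative_total_dx[OF diff(3)] has_field_derivative_total_dx[OF diff(4)]
    have "((\<lambda>s. \<psi> (x, s, u, v)) has_real_derivative
        total_dt \<phi> (x, t, 0, 0) * u + total_dt \<psi> (x, t, 0, 0)) (at t)"
      by (subst *) (rule derivative_eq_intros refl | simp)+
    then show "total_dt \<psi> (x, t, u, v) = total_dt \<phi> (x, t, 0, 0) * u + total_dt \<psi> (x, t, 0, 0)"
      by (simp add: total_dt.simps DERIV_imp_deriv)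
    have "((\<lambda>s. \<psi> (s, t, u, v)) has_real_derivative
        total_dx \<phi> (x, t, 0, 0) * u + total_dx \<psi> (x, t, 0, 0)) (at x)"
      by (subst *) (rule derivative_eq_intros refl | simp)+
    then show "total_dx \<psi> (x, t, u, v) = total_dx \<phi> (x, t, 0, 0) * u + total_dx \<psi> (x, t, 0, 0)"
      by (simp add: total_dx.simps DERIV_imp_deriv)
  qed
  have e1: "total_dt \<phi> (x, t, 0, 0) + total_dx \<phi> (x, t, 0, 0) * u = total_dx \<psi> (x, t, 0, 0)"
    and e2: "total_dt \<phi> (x, t, 0, 0) * u + total_dt \<psi> (x, t, 0, 0)
      = (1 - u\<^sup>2) * total_dx \<phi> (x, t, 0, 0)" for x t u
    using eqs(1,2)[of x t u 0] unfolding \<phi>x_indep[of x t u] \<phi>t_indep[of x t u] \<psi>t_affine[of x t u]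
      \<psi>x_affine[of x t u] by (simp_all add: algebra_simps)
  \<comment> \<open>The right side of \<open>e1\<close> is free of u, so the values at u = 0 and u =
    1 already isolate the coefficient of u.\<close>
  have \<phi>x0: "total_dx \<phi> (x, t, 0, 0) = 0" for x t
    using e1[of x t 0] e1[of x t 1] by simp
  have \<phi>t0: "total_dt \<phi> (x, t, 0, 0) = 0" and \<psi>t0: "total_dt \<psi> (x, t, 0, 0) = 0"
    and \<psi>x0: "total_dx \<psi> (x, t, 0, 0) = 0" for x t
    using e2[of x t 0] e2[of x t 1] e1[of x t 0] by (simp_all add: \<phi>x0)
  \<comment> \<open>Evaluating the desired formulas and \<tau>_t at the origin forces these
    choices.\<close>
  define c1 c2 c3 c4 c5 where
    "c1 = base_dt \<tau> (0, 0)" "c2 = \<tau> (0, 0)" "c3 = \<phi> (0, 0, 0, 0)" "c4 = \<xi> (0, 0)" "c5 = \<psi> (0, 0, 0, 0)"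
  note c = this
  have "\<phi> (x, t, 0, 0) = c3" for x t
  proof -
    have "\<phi> (x, t, 0, 0) = \<phi> (0, t, 0, 0)"
      by (rule const_if_zero_real_derivative[where f = "\<lambda>s. \<phi> (s, t, 0, 0)" and s = x and s' = 0])
        (rule has_field_derivative_total_dx[where u = 0 and v = 0, OF diff(3), unfolded \<phi>x0])
    also have "\<dots> = c3" unfolding c
      by (rule const_if_zero_real_derivative[where f = "\<lambda>s. \<phi> (0, s, 0, 0)" and s = t and s' = 0])
        (rule has_field_derivative_total_dt[where u = 0 and v = 0, OF diff(3), unfolded \<phi>t0])
    finally show ?thesis .
  qed
  then have \<xi>t: "base_dt \<xi> (x, t) = c3" for x t
    using \<phi>' by metis
  have \<psi>0: "\<psi> (x, t, 0, 0) = c5" for x t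
  proof -
    have "\<psi> (x, t, 0, 0) = \<psi> (0, t, 0, 0)"
      by (rule const_if_zero_real_derivative[where f = "\<lambda>s. \<psi> (s, t, 0, 0)" and s = x and s' = 0])
        (rule has_field_derivative_total_dx[where u = 0 and v = 0, OF diff(4), unfolded \<psi>x0])
    also have "\<dots> = c5" unfolding c
      by (rule const_if_zero_real_derivative[where f = "\<lambda>s. \<psi> (0, s, 0, 0)" and s = t and s' = 0])
        (rule has_field_derivative_total_dt[where u = 0 and v = 0, OF diff(4), unfolded \<psi>t0])
    finally show ?thesis .
  qed
  have \<tau>_indep: "\<tau> (x, t) = \<tau> (0, t)" for x t
    by (rule const_if_zero_real_derivative[where f = "\<lambda>s. \<tau> (s, t)" and s = x and s' = 0])
      (rule has_field_derivative_base_dx[OF diff(2), unfolded \<tau>x])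
  have \<xi>_split: "\<xi> (x, t) = c3 * t + \<xi> (x, 0)" for x t
    by (rule affine_if_const_real_derivative[where f = "\<lambda>s. \<xi> (x, s)" and s = t])
      (rule has_field_derivative_base_dt[OF diff(1), unfolded \<xi>t])
  have \<tau>t_indep: "base_dt \<tau> (x, t) = base_dt \<tau> (0, t)" for x t
    by (simp add: base_dt.simps \<tau>_indep[of x])
  have \<xi>x_indep: "base_dx \<xi> (x, t) = base_dx \<xi> (x, 0)" for x t
  proof -
    have "((\<lambda>s. \<xi> (s, t)) has_real_derivative base_dx \<xi> (x, 0)) (at x)"
      by (subst \<xi>_split) (rule derivative_eq_intros has_field_derivative_base_dx[OF diff(1)] refl | simp)+
    then show ?thesis by (simp add: base_dx.simps DERIV_imp_deriv)
  qed
  \<comment> \<open>Separation of variables: by \<open>a0\<close>, \<xi>_x = \<tau>_t, where \<xi>_x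
    depends on x alone and \<tau>_t on t alone, so both are constant.\<close>
  have \<tau>t: "base_dt \<tau> (x, t) = c1" and \<xi>x: "base_dx \<xi> (x, t) = c1" for x t
    using a0[of 0 t] a0[of 0 0] a0[of x t] \<tau>t_indep[of x t] \<xi>x_indep[of 0 t]
    unfolding a_def c by simp_all
  show ?thesis
  proof
    show "\<xi> (x, t) = c1 * x + c3 * t + c4" for x t
      using \<xi>_split[of x t]
        affine_if_const_real_derivative[OF has_field_derivative_base_dx[OF diff(1), unfolded \<xi>x], of x 0]
      by (simp add: c)
    show "\<tau> (x, t) = c1 * t + c2" for x t
      using \<tau>_indep[of x t]
        affine_if_const_real_derivative[OF has_field_derivative_base_dt[OF diff(2), unfolded \<tau>t], of 0 t]
      by (simp add: c)
    show "\<phi> (x, t, u, v) = c3" for x t u v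
      by (simp add: \<phi>' \<xi>t)
    show "\<psi> (x, t, u, v) = c3 * u + c5" for x t u v
      using \<psi>' by (simp add: \<psi>0 \<xi>t)
  qed
qed

text \<open>Here \<xi>_x = \<tau>_t = c1 and \<xi>_t = \<psi>_u = \<phi> = c3, all other partial
  derivatives vanish, and the terms cancel.\<close>

lemma affine_fields_satisfy_determining_equations:
  assumes "\<And>x t. \<xi> (x, t) = c1 * x + c3 * t + c4"
    and "\<And>x t. \<tau> (x, t) = c1 * t + c2"
    and "\<And>x t u v. \<phi> (x, t, u, v) = c3"
    and "\<And>x t u v. \<psi> (x, t, u, v) = c3 * u + c5"
  shows "determining_equations \<xi> \<tau> \<phi> \<psi> p"
proof -
  have deriv_affine: "deriv (\<lambda>s. m * s + b) y = m" for m b y :: real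
    by (rule DERIV_imp_deriv) (auto intro!: derivative_eq_intros)
  have "base_dx \<xi> (x, t) = c1" "base_dt \<xi> (x, t) = c3"
    "base_dx \<tau> (x, t) = 0" "base_dt \<tau> (x, t) = c1" for x t
    using deriv_affine[of c1 "c3 * t + c4" x] deriv_affine[of c3 "c1 * x + c4" t]
      deriv_affine[of c1 c2 t]
    by (simp_all add: base_dx.simps base_dt.simps assms algebra_simps)
  moreover have "total_dx \<phi> q = 0" "total_dt \<phi> q = 0" "total_du \<phi> q = 0" "total_dv \<phi> q = 0" for q
    by (cases q; simp add: total_dx.simps total_dt.simps total_du.simps total_dv.simps assms)+
  moreover have "total_dx \<psi> q = 0" "total_dt \<psi> q = 0" "total_du \<psi> q = c3" "total_dv \<psi> q = 0" for q
    by (cases q; simp add: total_dx.simps total_dt.simps total_du.simps total_dv.simps assms deriv_affine)+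
  ultimately show ?thesis
    by (cases p) (simp add: determining_equations_def assms algebra_simps)
qed


section \<open>The symmetry algebra\<close>

lemma smooth_imp_differentiable: "smooth f \<Longrightarrow> f differentiable (at p)"
  using C_diff.simps(2)[of 0 f] unfolding smooth_def by blast

lemma C_diff_const: "C_diff n (\<lambda>p. c)"
  by (induction n arbitrary: c) auto

text \<open>The derivative is \<open>L\<close> at every point, so each directional derivative is
  constant and \<open>C_diff_const\<close> covers all further orders.\<close>

lemma smooth_affine:
  assumes "bounded_linear L"
  shows "smooth (\<lambda>p. L p + c)"
  unfolding smooth_def
proof
  fix n
  have D: "((\<lambda>p. L p + c) has_derivative L) (at p)" for p
    using has_derivative_add_const[OF bounded_linear_imp_has_derivative[OF assms]] .
  show "C_diff n (\<lambda>p. L p + c)"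
  proof (cases n)
    case 0
    then show ?thesis
      using has_derivative_continuous_on[of UNIV, OF D] by simp
  next
    case (Suc m)
    have "frechet_derivative (\<lambda>p. L p + c) (at p) = L" for p
      by (rule frechet_derivative_at[OF D, symmetric])
    then show ?thesis
      using D by (auto simp: Suc differentiable_def C_diff_const)
  qed
qed

lemma projectable_vf_components_differentiable:
  assumes "\<And>p. projectable_vf \<xi> \<tau> \<phi> \<psi> differentiable (at p)"
  shows "\<xi> differentiable (at q)" "\<tau> differentiable (at q)"
    "\<phi> differentiable (at p)" "\<psi> differentiable (at p)"
proof -
  let ?X = "projectable_vf \<xi> \<tau> \<phi> \<psi>"
  have comp: "(\<lambda>q. pr (?X (g q))) differentiable (at q)"
    if "bounded_linear pr" "g differentiable (at q)"
    for pr :: "total \<Rightarrow> real" and g :: "'b::real_normed_vector \<Rightarrow> total" and q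
    using differentiable_compose[OF bounded_linear_imp_differentiable[OF that(1)]
        differentiable_compose[OF assms that(2)]] .
  note bl = bounded_linear_fst bounded_linear_snd bounded_linear_compose[OF _ bounded_linear_snd]
  \<comment> \<open>The section (x, t) \<mapsto> (x, t, 0, 0) recovers \<xi> and \<tau>, functions
    on the base, from the field on the total space.\<close>
  have g: "(\<lambda>q::base. (fst q, snd q, 0, 0) :: total) differentiable (at q)" for q
    by (auto intro!: derivative_eq_intros simp: differentiable_def)
  have 1: "\<xi> = (\<lambda>q. fst (?X (fst q, snd q, 0, 0)))" by auto
  have 2: "\<tau> = (\<lambda>q. fst (snd (?X (fst q, snd q, 0, 0))))" by auto
  have 3: "\<phi> = (\<lambda>p. fst (snd (snd (?X p))))" by auto
  have 4: "\<psi> = (\<lambda>p. snd (snd (snd (?X p))))" by auto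
  show "\<xi> differentiable (at q)"
    by (subst 1, rule comp[OF _ g]) (intro bl)
  show "\<tau> differentiable (at q)"
    by (subst 2, rule comp[OF _ g]) (intro bl)
  show "\<phi> differentiable (at p)"
    by (subst 3, rule comp[OF _ differentiable_ident]) (intro bl)
  show "\<psi> differentiable (at p)"
    by (subst 4, rule comp[OF _ differentiable_ident]) (intro bl)
qed

theorem infinitesimal_symmetry_iff:
  assumes "smooth (projectable_vf \<xi> \<tau> \<phi> \<psi>)"
  shows "infinitesimal_symmetry \<xi> \<tau> \<phi> \<psi> \<longleftrightarrow>
    (\<exists>c1 c2 c3 c4 c5 :: real.
      (\<forall>x t. \<xi> (x, t) = c1 * x + c3 * t + c4) \<and>
      (\<forall>x t. \<tau> (x, t) = c1 * t + c2) \<and>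
      (\<forall>x t u v. \<phi> (x, t, u, v) = c3) \<and>
      (\<forall>x t u v. \<psi> (x, t, u, v) = c3 * u + c5))" (is "_ \<longleftrightarrow> ?R")
proof
  assume "infinitesimal_symmetry \<xi> \<tau> \<phi> \<psi>"
  then have "\<And>p. determining_equations \<xi> \<tau> \<phi> \<psi> p"
    by (simp only: infinitesimal_symmetry_iff_determining_equations)
  from solve_determining_equations[OF
      projectable_vf_components_differentiable[OF smooth_imp_differentiable[OF assms]] this]
  show ?R by metis
next
  assume ?R
  then show "infinitesimal_symmetry \<xi> \<tau> \<phi> \<psi>"
    unfolding infinitesimal_symmetry_iff_determining_equations
    using affine_fields_satisfy_determining_equations by metis
qed

section \<open>Spanning and independence of the five generators\<close>

text \<open>A normal form through which the set of symmetries and the span are compared.\<close>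

definition symmetry_vf :: "real \<Rightarrow> real \<Rightarrow> real \<Rightarrow> real \<Rightarrow> real \<Rightarrow> total \<Rightarrow> total" where
  "symmetry_vf c1 c2 c3 c4 c5 = (\<lambda>(x, t, u, v). (c1 * x + c3 * t + c4, c1 * t + c2, c3, c3 * u + c5))"

lemma symmetry_vf_eq_projectable_vf:
  "symmetry_vf c1 c2 c3 c4 c5 = projectable_vf (\<lambda>(x, t). c1 * x + c3 * t + c4) (\<lambda>(x, t). c1 * t + c2)
    (\<lambda>_. c3) (\<lambda>(x, t, u, v). c3 * u + c5)"
  by (auto simp: fun_eq_iff symmetry_vf_def)

lemma smooth_symmetry_vf: "smooth (symmetry_vf c1 c2 c3 c4 c5)"
proof -
  let ?L = "\<lambda>p::total. (c1 * fst p + c3 * fst (snd p), c1 * fst (snd p), 0::real, c3 * fst (snd (snd p)))"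
  have "linear ?L"
    by (rule linearI) (auto simp: algebra_simps)
  then have "bounded_linear ?L"
    by (simp add: linear_conv_bounded_linear)
  from smooth_affine[OF this, of "(c4, c2, c3, c5)"] show ?thesis
    by (simp add: symmetry_vf_def case_prod_unfold)
qed

lemma projectable_symmetries_eq:
  "projectable_symmetries = {symmetry_vf c1 c2 c3 c4 c5 | c1 c2 c3 c4 c5. True}"
proof (intro equalityI subsetI)
  fix X assume "X \<in> projectable_symmetries"
  then obtain \<xi> \<tau> \<phi> \<psi> where X: "X = projectable_vf \<xi> \<tau> \<phi> \<psi>" and "smooth (projectable_vf \<xi> \<tau> \<phi> \<psi>)"
    and "infinitesimal_symmetry \<xi> \<tau> \<phi> \<psi>"
    by (auto simp: projectable_symmetries_def)
  then obtain c1 c2 c3 c4 c5 where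
    "(\<forall>x t. \<xi> (x, t) = c1 * x + c3 * t + c4) \<and> (\<forall>x t. \<tau> (x, t) = c1 * t + c2) \<and>
     (\<forall>x t u v. \<phi> (x, t, u, v) = c3) \<and> (\<forall>x t u v. \<psi> (x, t, u, v) = c3 * u + c5)"
    using infinitesimal_symmetry_iff by meson
  then have "X = symmetry_vf c1 c2 c3 c4 c5"
    by (simp add: X symmetry_vf_def fun_eq_iff)
  then show "X \<in> {symmetry_vf c1 c2 c3 c4 c5 | c1 c2 c3 c4 c5. True}"
    by blast
next
  fix X assume "X \<in> {symmetry_vf c1 c2 c3 c4 c5 | c1 c2 c3 c4 c5. True}"
  then obtain c1 c2 c3 c4 c5 where X: "X = symmetry_vf c1 c2 c3 c4 c5"
    by blast
  have "infinitesimal_symmetry (\<lambda>(x, t). c1 * x + c3 * t + c4) (\<lambda>(x, t). c1 * t + c2)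
      (\<lambda>_. c3) (\<lambda>(x, t, u, v). c3 * u + c5)"
    unfolding infinitesimal_symmetry_iff_determining_equations
    by (intro allI affine_fields_satisfy_determining_equations) auto
  then show "X \<in> projectable_symmetries"
    using smooth_symmetry_vf[of c1 c2 c3 c4 c5]
    unfolding projectable_symmetries_def X symmetry_vf_eq_projectable_vf by blast
qed

text \<open>The right-nested sum has the shape to which a finite sum over the generators
  unfolds.\<close>

lemma symmetry_vf_eq_sum:
  "symmetry_vf c1 c2 c3 c4 c5 =
    scale_vf c1 w1 + (scale_vf c2 w2 + (scale_vf c3 w3 + (scale_vf c4 w4 + scale_vf c5 w5)))"
  by (auto simp: fun_eq_iff symmetry_vf_def scale_vf_def w1_def w2_def w3_def w4_def w5_def)

lemma span_eq_symmetry_vf: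
  "vf.span {w1, w2, w3, w4, w5} = {symmetry_vf c1 c2 c3 c4 c5 | c1 c2 c3 c4 c5. True}"
proof -
  have "X \<in> vf.span {w1, w2, w3, w4, w5} \<longleftrightarrow> (\<exists>c1 c2 c3 c4 c5. X = symmetry_vf c1 c2 c3 c4 c5)" for X
    unfolding symmetry_vf_eq_sum
    \<comment> \<open>Peeling off one generator at a time ends in the span of the empty set, which
      forces the remainder to be 0.\<close>
    by (simp add: vf.span_insert vf.span_empty algebra_simps)
  then show ?thesis by blast
qed

text \<open>The value at the origin is (c4, c2, c3, c5); the first component at (1, 0, 0, 0) is c1 +
  c4.\<close>

lemma symmetry_vf_eq_0_iff:
  "symmetry_vf c1 c2 c3 c4 c5 = 0 \<longleftrightarrow> c1 = 0 \<and> c2 = 0 \<and> c3 = 0 \<and> c4 = 0 \<and> c5 = 0"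
proof
  assume "symmetry_vf c1 c2 c3 c4 c5 = 0"
  then have "symmetry_vf c1 c2 c3 c4 c5 (0, 0, 0, 0) = 0" "symmetry_vf c1 c2 c3 c4 c5 (1, 0, 0, 0) = 0"
    by simp_all
  then show "c1 = 0 \<and> c2 = 0 \<and> c3 = 0 \<and> c4 = 0 \<and> c5 = 0"
    by (simp add: symmetry_vf_def zero_prod_def)
qed (auto simp: symmetry_vf_def fun_eq_iff zero_prod_def)

text \<open>Needed for the sum over the set of generators to have five terms and for the
  cardinality. One point at which the five values differ is enough.\<close>

lemma distinct_generators: "distinct [w1, w2, w3, w4, w5]"
proof -
  have "distinct (map (\<lambda>w. w (1, 2, 3, 4)) [w1, w2, w3, w4, w5])"
    by (simp add: w1_def w2_def w3_def w4_def w5_def)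
  then show ?thesis
    unfolding distinct_map by blast
qed

lemma independent_generators: "\<not> vf.dependent {w1, w2, w3, w4, w5}"
proof -
  have "c w1 = 0 \<and> c w2 = 0 \<and> c w3 = 0 \<and> c w4 = 0 \<and> c w5 = 0"
    if "(\<Sum>w\<in>{w1, w2, w3, w4, w5}. scale_vf (c w) w) = 0" for c
  proof -
    have "symmetry_vf (c w1) (c w2) (c w3) (c w4) (c w5) = 0"
      using that distinct_generators by (simp add: symmetry_vf_eq_sum)
    then show ?thesis
      by (simp add: symmetry_vf_eq_0_iff)
  qed
  then show ?thesis
    by (subst vf.dependent_finite) auto
qed

text \<open>The cardinality complements independence, which for a set does not detect repetitions
  among the listed fields.\<close>

theorem mainTheorem5:
  shows
    "(\<forall>(u :: base \<Rightarrow> real) (v :: base \<Rightarrow> real) p.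
        u differentiable (at p) \<and> v differentiable (at p) \<longrightarrow>
        (Delta1 (jet_of u v p) = 0 \<and> Delta2 (jet_of u v p) = 0 \<longleftrightarrow>
         base_dt u p + base_dx (\<lambda>q. (u q)\<^sup>2 - v q) p = 0 \<and>
         base_dt v p + base_dx (\<lambda>q. 1 / 3 * (u q) ^ 3 - u q) p = 0)) \<and>
     (\<forall>\<xi> \<tau> \<phi> \<psi>. smooth (projectable_vf \<xi> \<tau> \<phi> \<psi>) \<longrightarrow>
        (infinitesimal_symmetry \<xi> \<tau> \<phi> \<psi> \<longleftrightarrow>
         (\<exists>c1 c2 c3 c4 c5 :: real.
            (\<forall>x t. \<xi> (x, t) = c1 * x + c3 * t + c4) \<and>
            (\<forall>x t. \<tau> (x, t) = c1 * t + c2) \<and>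
            (\<forall>x t u v. \<phi> (x, t, u, v) = c3) \<and>
            (\<forall>x t u v. \<psi> (x, t, u, v) = c3 * u + c5)))) \<and>
     projectable_symmetries = vf.span {w1, w2, w3, w4, w5} \<and>
     \<not> vf.dependent {w1, w2, w3, w4, w5} \<and>
     card {w1, w2, w3, w4, w5} = 5"
proof (intro conjI allI impI, goal_cases)
  case (1 u v p)
  then show ?case
    by (intro system_iff_conservation_laws) auto
next
  case (2 \<xi> \<tau> \<phi> \<psi>)
  then show ?case
    by (rule infinitesimal_symmetry_iff)
next
  case 3
  show ?case
    by (simp only: projectable_symmetries_eq span_eq_symmetry_vf)
next
  case 4
  show ?case
    by (rule independent_generators)
next
  case 5
  show ?case
    using distinct_card[OF distinct_generators] by simp
qed

end
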